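(* For all integers $n\ge 0$, $\overline{SOME}(n)\ge 0$.
   Context: An overpartition of a nonnegative integer $n$ is a partition of $n$ in which the first occurrence of each distinct part may be overlined (or not). For $n\ge 0$, $\overline{SOME}(n)$ denotes the sum, over all overpartitions $\lambda$ of $n$, of (the sum of the odd parts of $\lambda$) minus (the sum of the even parts of $\lambda$), where parts are counted with multiplicity and an overlined part counts with its numerical size. *)

theory Defs
  imports Main "HOL-Library.Multiset"
begin

text \<open>
  A pair \<open>(M, S)\<close>: \<open>M\<close> is the multiset of parts (ignoring overlines), and \<open>S\<close> is the set of those
  distinct parts whose first occurrence is overlined. Since only first occurrences may be
  overlined, \<open>S\<close> determines the overlining.
\<close>

definition overpartitions :: "nat \<Rightarrow> (nat multiset \<times> nat set) set" where
  "overpartitions n = {(M, S). 0 \<notin># M \<and> sum_mset M = n \<and> S \<subseteq> set_mset M}"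

definition odd_parts_sum :: "nat multiset \<Rightarrow> nat" where
  "odd_parts_sum M = sum_mset (filter_mset odd M)"

definition even_parts_sum :: "nat multiset \<Rightarrow> nat" where
  "even_parts_sum M = sum_mset (filter_mset even M)"

definition SOME_bar :: "nat \<Rightarrow> int" where
  "SOME_bar n = (\<Sum>(M, S) \<in> overpartitions n. int (odd_parts_sum M) - int (even_parts_sum M))"

text \<open>The index set of the sum is finite, so the sum does not take its default value 0.\<close>

lemma size_le_sum_mset: "0 \<notin># M \<Longrightarrow> size M \<le> sum_mset M" for M :: "nat multiset"
  by (induction M) auto

lemma finite_overpartitions: "finite (overpartitions n)"
proof (rule finite_subset)
  show "overpartitions n \<subseteq> (\<Union>k\<le>n. multisets_of_size {..n} k) \<times> Pow {..n}"
  proof (rule subrelI)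
    fix M S assume "(M, S) \<in> overpartitions n"
    then have *: "0 \<notin># M" "sum_mset M = n" "S \<subseteq> set_mset M"
      by (auto simp: overpartitions_def)
    have "set_mset M \<subseteq> {..n}"
      using *(2) by (auto dest: multi_member_split)
    then show "(M, S) \<in> (\<Union>k\<le>n. multisets_of_size {..n} k) \<times> Pow {..n}"
      using * size_le_sum_mset[of M] by (auto simp: multisets_of_size_def)
  qed
  show "finite ((\<Union>k\<le>n. multisets_of_size {..n} k) \<times> Pow {..n})"
    by (auto intro: finite_multisets_of_size)
qed

end

theory Submission
  imports Defs "HOL-Computational_Algebra.Formal_Power_Series"
begin

text \<open>
  Let \<open>O\<close> and \<open>E\<close> be the generating functions of the overpartitions into odd parts and into
  even parts. Splitting an overpartition into its odd and its even parts shows that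
  \<open>SOME_bar\<close> has the generating function \<open>X (O' E - O E') = E\<^sup>2 X (O / E)'\<close>
  (\<open>SOME_bar_gf\<close>). Hence it suffices that the quotient \<open>O / E\<close> has nonnegative coefficients.

  In fact \<open>O / E = \<theta> = 1 + 2 (X + X\<^sup>4 + X\<^sup>9 + \<dots>)\<close> (\<open>odd_overpartition_gf\<close>). The part \<open>k\<close>
  contributes the factor \<open>(1 + X\<^sup>k) / (1 - X\<^sup>k)\<close> to the generating function of
  overpartitions, so \<open>O / E\<close> is the product of these factors over odd \<open>k\<close> and of their
  inverses over even \<open>k\<close>. With \<open>x = - X\<close> this is the product of
  \<open>(1 - x\<^sup>k) / (1 + x\<^sup>k)\<close> over all \<open>k > 0\<close>, which by an identity of Gauss equals
  \<open>1 + 2 \<Sum>\<^sub>j (- 1)\<^sup>j x^(j\<^sup>2)\<close>; the signs disappear because \<open>j\<close> and \<open>j\<^sup>2\<close> have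
  the same parity. Gauss' identity is used in a finite form due to Shanks
  (\<open>shanks_gauss\<close>), read modulo a power of \<open>X\<close>.
\<close>

section \<open>Shanks' finite form of Gauss' identity\<close>

text \<open>
  Every summand on the right except the product of the \<open>1 - x\<^sup>k\<close> is a multiple of
  \<open>x\<^sup>n\<^sup>+\<^sup>1\<close>, so for \<open>x = - X\<close> the limit \<open>n \<rightarrow> \<infinity>\<close> is Gauss' identity. The
  denominators \<open>1 + x\<^sup>k\<close> are cleared to make the identity hold in every commutative ring.
  In the induction step both sides are compared after multiplying the old identity by the new
  factor \<open>1 + x\<^sup>n\<close>; the resulting differences of summands on the right telescope.
\<close>

lemma shanks_gauss:
  fixes x :: "'a :: comm_ring_1"
  shows "(\<Prod>k=1..n. 1 + x ^ k) * (1 + 2 * (\<Sum>j=1..n. (-1) ^ j * x ^ j\<^sup>2)) =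
    (\<Prod>k=1..n. 1 - x ^ k) +
    2 * (\<Sum>s=1..n. (-1) ^ s * (\<Prod>k=1..<s. 1 + x ^ k) * (\<Prod>k=s+1..n. 1 - x ^ k) * x ^ (s * (n + 1)))"
proof (induction n)
  case 0
  show ?case by simp
next
  case (Suc m)
  define D where "D = (\<lambda>s. \<Prod>k=1..<s. 1 + x ^ k)"
  define N where "N = (\<lambda>s n. \<Prod>k=s+1..n. 1 - x ^ k)"
  define t where "t = (\<lambda>s n. (-1) ^ s * D s * N s n * x ^ (s * (n + 1)))"
  define n where "n = Suc m"
  define W where "W = (\<lambda>s. (-1) ^ s * D s * N (s - 1) m * x ^ (s * n))"
  have D_Suc: "D (Suc s) = D s * (1 + x ^ s)" if "s \<ge> 1" for s
    using that by (simp add: D_def)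
  have N_top: "N s n = N s m * (1 - x ^ n)" if "s \<le> m" for s
    using that by (simp add: N_def n_def)
  have N_bot: "N (s - 1) m = (1 - x ^ s) * N s m" if "1 \<le> s" "s \<le> m" for s
    using that by (simp add: N_def prod.atLeast_Suc_atMost)
  \<comment> \<open>The telescoping rests on \<open>x\<^sup>s (1 - x\<^sup>n) - (1 + x\<^sup>n) = - (1 - x\<^sup>s) - x\<^sup>n (1 + x\<^sup>s)\<close>:
    the first summand extends the product \<open>N\<close> downwards, the second the product \<open>D\<close> upwards.\<close>
  have step: "t s n - (1 + x ^ n) * t s m = W (Suc s) - W s" if "s \<in> {1..m}" for s
  proof -
    have s: "1 \<le> s" "s \<le> m" using that by auto
    have e: "x ^ (s * (m + 1)) = x ^ (s * n)" "x ^ (s * (n + 1)) = x ^ (s * n) * x ^ s"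
      "x ^ (Suc s * n) = x ^ (s * n) * x ^ n"
      by (simp_all add: n_def power_add [symmetric] algebra_simps)
    show ?thesis
      unfolding t_def W_def e D_Suc[OF s(1)] N_top[OF s(2)] N_bot[OF s] diff_Suc_1
      by (simp add: algebra_simps)
  qed
  have "(\<Sum>s=1..m. t s n) - (1 + x ^ n) * (\<Sum>s=1..m. t s m) = (\<Sum>s=1..m. W (Suc s) - W s)"
    using step by (simp add: sum_distrib_left flip: sum_subtractf)
  also have "\<dots> = W n - W 1"
    by (subst sum_Suc_diff) (auto simp: n_def)
  finally have tele: "(\<Sum>s=1..m. t s n) = (1 + x ^ n) * (\<Sum>s=1..m. t s m) + W n - W 1"
    by (simp add: algebra_simps)
  have W1: "W 1 = - N 0 m * x ^ n" by (simp add: W_def D_def)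
  have Wn: "W n = (-1) ^ n * D n * x ^ n\<^sup>2"
    by (simp add: W_def N_def n_def power2_eq_square)
  have tn: "t n n = (-1) ^ n * D n * x ^ n\<^sup>2 * x ^ n"
    by (simp add: t_def N_def n_def power2_eq_square power_add [symmetric] algebra_simps)
  have Dn: "(\<Prod>k=1..m. 1 + x ^ k) = D n"
    by (simp add: D_def n_def atLeastLessThanSuc_atLeastAtMost)
  have IH: "D n * (1 + 2 * (\<Sum>j=1..m. (-1) ^ j * x ^ j\<^sup>2)) = N 0 m + 2 * (\<Sum>s=1..m. t s m)"
    using Suc.IH unfolding Dn by (simp add: D_def N_def t_def)
  have "D n * (1 + x ^ n) * (1 + 2 * ((\<Sum>j=1..m. (-1) ^ j * x ^ j\<^sup>2) + (-1) ^ n * x ^ n\<^sup>2)) =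
      (1 + x ^ n) * (N 0 m + 2 * (\<Sum>s=1..m. t s m)) + 2 * ((-1) ^ n * D n * x ^ n\<^sup>2 * (1 + x ^ n))"
    unfolding IH [symmetric] by (simp add: algebra_simps)
  also have "\<dots> = N 0 m * (1 - x ^ n) + 2 * ((\<Sum>s=1..m. t s n) + t n n)"
    unfolding tele W1 Wn tn by (simp add: algebra_simps)
  finally show ?case
    using Dn N_top[of 0] by (simp add: D_def N_def t_def n_def)
qed


section \<open>Power series modulo powers of \<open>X\<close>\<close>

lemma fps_X_power_dvd_iff:
  "fps_X ^ m dvd (f :: 'a :: comm_ring_1 fps) \<longleftrightarrow> (\<forall>i<m. fps_nth f i = 0)"
proof
  assume "fps_X ^ m dvd f"
  then show "\<forall>i<m. fps_nth f i = 0" by (auto simp: dvd_def fps_X_power_mult_nth)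
next
  assume "\<forall>i<m. fps_nth f i = 0"
  then have "f = fps_X ^ m * fps_shift m f"
    by (intro fps_ext) (auto simp: fps_X_power_mult_nth)
  then show "fps_X ^ m dvd f" by (rule dvdI)
qed

lemma fps_X_power_dvd_cancel:
  fixes f g :: "'a :: idom fps"
  assumes "fps_X ^ m dvd g * f" and "fps_nth g 0 \<noteq> 0"
  shows "fps_X ^ m dvd f"
proof (cases "f = 0")
  case False
  have "g \<noteq> 0" "subdegree g = 0" using assms(2) by auto
  then have "subdegree (g * f) = subdegree f" "g * f \<noteq> 0" using False by auto
  moreover have "m \<le> subdegree (g * f)"
    using assms(1) \<open>g * f \<noteq> 0\<close> by (intro subdegree_geI) (auto simp: fps_X_power_dvd_iff)
  ultimately show ?thesis by (auto simp: fps_X_power_dvd_iff intro: nth_less_subdegree_zero)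
qed simp


section \<open>Overpartitions with parts in a given set\<close>

definition overpartitions_in :: "nat set \<Rightarrow> nat \<Rightarrow> (nat multiset \<times> nat set) set" where
  "overpartitions_in K n = {(M, S) \<in> overpartitions n. set_mset M \<subseteq> K}"

definition overpartition_gf :: "nat set \<Rightarrow> int fps" where
  "overpartition_gf K = Abs_fps (\<lambda>n. int (card (overpartitions_in K n)))"

lemma mem_overpartitions_in:
  "(M, S) \<in> overpartitions_in K n \<longleftrightarrow>
     0 \<notin># M \<and> sum_mset M = n \<and> S \<subseteq> set_mset M \<and> set_mset M \<subseteq> K"
  by (auto simp: overpartitions_in_def overpartitions_def)

lemma finite_overpartitions_in [simp]: "finite (overpartitions_in K n)"
  by (rule finite_subset[OF _ finite_overpartitions[of n]]) (auto simp: overpartitions_in_def)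

text \<open>
  An overpartition containing \<open>k\<close> either has a copy of \<open>k\<close> that is not overlined, and removing
  it leaves an arbitrary overpartition with the same parts allowed, or its only \<open>k\<close> is the
  overlined one, and removing it leaves an overpartition without the part \<open>k\<close>.
\<close>

lemma overpartitions_in_insert:
  assumes "k > 0" "k \<notin> K"
  shows "overpartitions_in (insert k K) n = overpartitions_in K n \<union>
    (if n < k then {} else
      (\<lambda>(M, S). (add_mset k M, S)) ` overpartitions_in (insert k K) (n - k) \<union>
      (\<lambda>(M, S). (add_mset k M, insert k S)) ` overpartitions_in K (n - k))"
    (is "?L = ?R")
proof (rule Set.equalityI; rule subrelI)
  fix M S assume L: "(M, S) \<in> ?L"
  show "(M, S) \<in> ?R"
  proof (cases "k \<in># M")
    case False
    then have "(M, S) \<in> overpartitions_in K n" using L by (auto simp: mem_overpartitions_in)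
    then show ?thesis by blast
  next
    case True
    then obtain M' where M: "M = add_mset k M'" by (blast dest: multi_member_split)
    have n: "\<not> n < k" "sum_mset M' = n - k"
      using L by (auto simp: M mem_overpartitions_in)
    show ?thesis
    proof (cases "S \<subseteq> set_mset M'")
      case True
      then have "(M', S) \<in> overpartitions_in (insert k K) (n - k)"
        using L n by (auto simp: M mem_overpartitions_in)
      then show ?thesis using n(1) by (force simp: M)
    next
      case False
      then have k: "k \<in> S" "k \<notin># M'" using L by (auto simp: M mem_overpartitions_in)
      then have "(M', S - {k}) \<in> overpartitions_in K (n - k)"
        using L n by (auto simp: M mem_overpartitions_in)
      then have "(M, S) \<in> (\<lambda>(M, S). (add_mset k M, insert k S)) ` overpartitions_in K (n - k)"
        using k by (force simp: M insert_absorb)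
      then show ?thesis using n(1) by simp
    qed
  qed
next
  fix M S assume "(M, S) \<in> ?R"
  then show "(M, S) \<in> ?L"
    using assms(1) by (auto simp: mem_overpartitions_in split: if_splits)
qed

text \<open>The three kinds of overpartitions in the preceding decomposition give the three terms of
  \<open>G' = G + X\<^sup>k G' + X\<^sup>k G\<close>, where \<open>G\<close> and \<open>G'\<close> are the generating functions without and with
  the part \<open>k\<close>.\<close>

lemma overpartition_gf_insert:
  assumes "k > 0" "k \<notin> K"
  shows "overpartition_gf (insert k K) * (1 - fps_X ^ k) = overpartition_gf K * (1 + fps_X ^ k)"
proof -
  have "overpartition_gf (insert k K) = overpartition_gf K +
      fps_X ^ k * (overpartition_gf (insert k K) + overpartition_gf K)"
  proof (rule fps_ext)
    fix n
    show "fps_nth (overpartition_gf (insert k K)) n = fps_nth (overpartition_gf K +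
      fps_X ^ k * (overpartition_gf (insert k K) + overpartition_gf K)) n"
    proof (cases "n < k")
      case True
      then show ?thesis using overpartitions_in_insert[OF assms, of n]
        by (simp add: overpartition_gf_def fps_X_power_mult_nth)
    next
      case False
      define A where "A = overpartitions_in K n"
      define B where "B = (\<lambda>(M, S). (add_mset k M, S)) ` overpartitions_in (insert k K) (n - k)"
      define C where "C = (\<lambda>(M, S). (add_mset k M, insert k S)) ` overpartitions_in K (n - k)"
      have "card (overpartitions_in (insert k K) n) = card (A \<union> (B \<union> C))"
        using overpartitions_in_insert[OF assms, of n] False by (simp add: A_def B_def C_def)
      also have "\<dots> = card A + (card B + card C)"
      proof -
        have "A \<inter> (B \<union> C) = {}"
          using assms by (fastforce simp: A_def B_def C_def mem_overpartitions_in)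
        moreover have "B \<inter> C = {}"
          using assms by (fastforce simp: B_def C_def mem_overpartitions_in)
        moreover have "finite A" "finite B" "finite C"
          by (simp_all add: A_def B_def C_def)
        ultimately show ?thesis by (simp add: card_Un_disjoint)
      qed
      also have "card B = card (overpartitions_in (insert k K) (n - k))"
        unfolding B_def by (rule card_image) (auto simp: inj_on_def)
      also have "card C = card (overpartitions_in K (n - k))"
        unfolding C_def
      proof (rule card_image, rule inj_onI, clarify)
        fix M S M' S'
        assume *: "(M, S) \<in> overpartitions_in K (n - k)" "(M', S') \<in> overpartitions_in K (n - k)"
          "add_mset k M = add_mset k M'" "insert k S = insert k S'"
        then have "k \<notin> S" "k \<notin> S'" using assms(2) by (auto simp: mem_overpartitions_in)
        then show "M = M' \<and> S = S'" using * by auto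
      qed
      finally show ?thesis using False
        by (simp add: overpartition_gf_def fps_X_power_mult_nth A_def)
    qed
  qed
  then show ?thesis by (simp add: algebra_simps)
qed

text \<open>Parts larger than the number are never used. This reduces the infinite products to
  finite ones, one coefficient at a time.\<close>

lemma overpartitions_in_atMost:
  assumes "i \<le> n"
  shows "overpartitions_in (K \<inter> {..n}) i = overpartitions_in K i"
proof -
  have "x \<le> n" if "x \<in># M" "sum_mset M = i" for x and M :: "nat multiset"
    using assms that by (auto dest!: multi_member_split)
  then show ?thesis by (auto simp: mem_overpartitions_in)
qed


section \<open>Odd parts against even parts\<close>

text \<open>Jacobi's theta series \<open>\<Sum>\<^sub>j X^(j\<^sup>2)\<close> over all integers \<open>j\<close>: a positive square has two
  square roots.\<close>

definition theta :: "int fps" where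
  "theta = Abs_fps (\<lambda>m. if m = 0 then 1 else if \<exists>j. m = j\<^sup>2 then 2 else 0)"

lemma theta_nth_eq_partial_sum:
  assumes "i \<le> n"
  shows "fps_nth theta i = fps_nth (1 + 2 * (\<Sum>j=1..n. fps_X ^ j\<^sup>2)) i"
proof -
  have "fps_nth (\<Sum>j=1..n. fps_X ^ j\<^sup>2) i = (\<Sum>j=1..n. if i = j\<^sup>2 then 1 else 0 :: int)"
    by (simp add: fps_sum_nth)
  also have "\<dots> = (if i > 0 \<and> (\<exists>j. i = j\<^sup>2) then 1 else 0)"
  proof (cases "i > 0 \<and> (\<exists>j. i = j\<^sup>2)")
    case True
    then obtain r where r: "i = r\<^sup>2" "r > 0" by fastforce
    then have "r \<le> n" using assms by (simp add: power2_nat_le_imp_le)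
    then show ?thesis using True r by (simp add: power2_eq_iff_nonneg sum.delta)
  next
    case False
    then show ?thesis by (auto intro!: sum.neutral)
  qed
  finally show ?thesis
    by (auto simp: theta_def fps_numeral_nth numeral_fps_const)
qed

text \<open>
  The substitution \<open>x = - X\<close> separates the parities: \<open>(1 - x\<^sup>k) / (1 + x\<^sup>k)\<close> is the factor by
  which an odd part \<open>k\<close> enters, and the inverse of the factor by which an even part \<open>k\<close> enters.
\<close>

lemma odd_even_overpartition_gf_ratio:
  "(\<Prod>k=1..n. 1 + (- fps_X) ^ k) * overpartition_gf (Collect odd \<inter> {..n}) =
   (\<Prod>k=1..n. 1 - (- fps_X) ^ k) * overpartition_gf (Collect even \<inter> {..n})"
proof (induction n)
  case 0
  have "overpartitions_in (Collect odd \<inter> {..0}) n = overpartitions_in (Collect even \<inter> {..0}) n" for n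
  proof -
    have "set_mset M \<subseteq> {0} \<longleftrightarrow> set_mset M \<subseteq> {}" if "0 \<notin># M" for M :: "nat multiset"
      using that by blast
    then show ?thesis by (auto simp: mem_overpartitions_in)
  qed
  then show ?case by (simp add: overpartition_gf_def)
next
  case (Suc n)
  let ?O = "\<lambda>n. overpartition_gf (Collect odd \<inter> {..n})"
  let ?E = "\<lambda>n. overpartition_gf (Collect even \<inter> {..n})"
  let ?D = "\<Prod>k=1..n. 1 + (- fps_X) ^ k :: int fps"
  let ?N = "\<Prod>k=1..n. 1 - (- fps_X) ^ k :: int fps"
  let ?X = "fps_X ^ Suc n :: int fps"
  have atMost_step: "K \<inter> {..Suc n} = (if Suc n \<in> K then insert (Suc n) (K \<inter> {..n}) else K \<inter> {..n})"
    for K by (auto simp: atMost_Suc)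
  note ins = overpartition_gf_insert[of "Suc n" "K \<inter> {..n}" for K]
  show ?case
  proof (cases "odd (Suc n)")
    case True
    then have sg: "(- fps_X) ^ Suc n = - ?X" by (rule power_minus_odd)
    have O: "?O (Suc n) * (1 - ?X) = ?O n * (1 + ?X)" and E: "?E (Suc n) = ?E n"
      using True ins[of "Collect odd"] by (simp_all add: atMost_step del: power_Suc)
    have "?D * (1 - ?X) * ?O (Suc n) = (?D * ?O n) * (1 + ?X)"
      using O by (simp add: mult_ac del: power_Suc)
    also have "\<dots> = ?N * (1 + ?X) * ?E (Suc n)"
      by (subst Suc.IH) (simp add: E mult_ac del: power_Suc)
    finally show ?thesis by (simp add: sg prod.nat_ivl_Suc' mult_ac del: power_Suc)
  next
    case False
    then have sg: "(- fps_X) ^ Suc n = ?X" by (intro power_minus_even) simp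
    have E: "?E (Suc n) * (1 - ?X) = ?E n * (1 + ?X)" and O: "?O (Suc n) = ?O n"
      using False ins[of "Collect even"] by (simp_all add: atMost_step del: power_Suc)
    have "?N * (1 - ?X) * ?E (Suc n) = (?N * ?E n) * (1 + ?X)"
      using E by (simp add: mult_ac del: power_Suc)
    also have "\<dots> = ?D * (1 + ?X) * ?O (Suc n)"
      by (subst Suc.IH[symmetric]) (simp add: O mult_ac del: power_Suc)
    finally show ?thesis by (simp add: sg prod.nat_ivl_Suc' mult_ac del: power_Suc)
  qed
qed

text \<open>
  The coefficient of \<open>X\<^sup>n\<close> is compared modulo \<open>X\<^sup>n\<^sup>+\<^sup>1\<close>, with parts at most \<open>n\<close>: there the
  error terms of Shanks' identity vanish, and the product \<open>D\<close> of the \<open>1 + x\<^sup>k\<close> can be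
  cancelled because its constant coefficient is 1.
\<close>

lemma odd_overpartition_gf:
  "overpartition_gf (Collect odd) = theta * overpartition_gf (Collect even)"
proof (rule fps_ext)
  fix n :: nat
  let ?O = "overpartition_gf (Collect odd)" and ?O' = "overpartition_gf (Collect odd \<inter> {..n})"
  let ?E = "overpartition_gf (Collect even)" and ?E' = "overpartition_gf (Collect even \<inter> {..n})"
  let ?x = "- fps_X :: int fps"
  let ?P = "fps_X ^ Suc n :: int fps"
  define D where "D = (\<Prod>k=1..n. 1 + ?x ^ k)"
  define N where "N = (\<Prod>k=1..n. 1 - ?x ^ k)"
  define S :: "int fps" where "S = 1 + 2 * (\<Sum>j=1..n. fps_X ^ j\<^sup>2)"
  \<comment> \<open>The sign of Gauss' series cancels that of \<open>x = - X\<close>.\<close>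
  have sq: "(-1) ^ j * ?x ^ j\<^sup>2 = fps_X ^ j\<^sup>2" for j
  proof -
    have "even (j + j\<^sup>2)" by simp
    then have "(-1) ^ (j + j\<^sup>2) = (1 :: int fps)" by (rule neg_one_even_power)
    moreover have "?x ^ j\<^sup>2 = (-1) ^ j\<^sup>2 * fps_X ^ j\<^sup>2" by (rule power_minus)
    ultimately show ?thesis by (simp add: power_add flip: mult.assoc)
  qed
  have "?P dvd D * S - N"
  proof -
    have "?P dvd ?x ^ (s * (n + 1))" if "s \<in> {1..n}" for s
    proof -
      have "?P dvd fps_X ^ (s * (n + 1))" using that mult_le_mono1[of 1 s "n + 1"] by (intro le_imp_power_dvd) auto
      then show ?thesis by (subst power_minus) (rule dvd_mult)
    qed
    then show ?thesis
      using shanks_gauss[where x = ?x and n = n]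
      unfolding D_def N_def S_def sq by (auto intro!: dvd_mult dvd_sum simp del: power_Suc)
  qed
  then have "?P dvd D * (?O' - S * ?E')"
  proof -
    have "D * (?O' - S * ?E') = - (D * S - N) * ?E'"
      using odd_even_overpartition_gf_ratio[of n] by (simp add: D_def N_def algebra_simps)
    then show ?thesis using \<open>?P dvd D * S - N\<close> by (metis dvd_minus_iff dvd_mult2)
  qed
  moreover have "fps_nth D 0 = 1"
    unfolding D_def by (induction n) (simp_all add: prod.nat_ivl_Suc')
  ultimately have "?P dvd ?O' - S * ?E'"
    by (metis fps_X_power_dvd_cancel zero_neq_one)
  then have "fps_nth ?O' n = fps_nth (S * ?E') n"
    by (auto simp: fps_X_power_dvd_iff simp del: power_Suc)
  also have "fps_nth ?O' n = fps_nth ?O n"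
    by (simp add: overpartition_gf_def overpartitions_in_atMost)
  also have "fps_nth (S * ?E') n = fps_nth (theta * ?E) n"
    unfolding fps_mult_nth
  proof (rule sum.cong)
    fix i assume "i \<in> {0..n}"
    then show "fps_nth S i * fps_nth ?E' (n - i) = fps_nth theta i * fps_nth ?E (n - i)"
      by (simp add: S_def theta_nth_eq_partial_sum[of i n] overpartition_gf_def overpartitions_in_atMost
               del: fps_add_nth)
  qed simp
  finally show "fps_nth ?O n = fps_nth (theta * ?E) n" .
qed


section \<open>The statistic\<close>

lemma odd_even_mset_partition: "filter_mset odd M + filter_mset even M = M"
  using multiset_partition[of M even] by (simp add: add.commute)

text \<open>An overpartition of \<open>n\<close> splits uniquely into one of some \<open>a\<close> with odd parts and one of
  \<open>n - a\<close> with even parts, and the statistic sees only \<open>a\<close>.\<close>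

lemma SOME_bar_eq_convolution:
  "SOME_bar n = (\<Sum>a=0..n. (int a - int (n - a)) *
     (int (card (overpartitions_in (Collect odd) a)) * int (card (overpartitions_in (Collect even) (n - a)))))"
proof -
  let ?O = "overpartitions_in (Collect odd)" and ?E = "overpartitions_in (Collect even)"
  have "SOME_bar n = (\<Sum>(a, y) \<in> (SIGMA a:{0..n}. ?O a \<times> ?E (n - a)). int a - int (n - a))"
    unfolding SOME_bar_def
  proof (rule sum.reindex_bij_witness[where
      j = "\<lambda>(M, S). (sum_mset (filter_mset odd M),
             (filter_mset odd M, S \<inter> Collect odd), (filter_mset even M, S \<inter> Collect even))" and
      i = "\<lambda>(a, (M, S), (M', S')). (M + M', S \<union> S')"], goal_cases)
    case (1 p)
    obtain M S where p: "p = (M, S)" by force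
    show ?case by (auto simp: p odd_even_mset_partition)
  next
    case (2 p)
    obtain M S where p: "p = (M, S)" by force
    have "sum_mset M = sum_mset (filter_mset odd M) + sum_mset (filter_mset even M)"
      by (simp flip: sum_mset.union add: odd_even_mset_partition)
    then show ?case using 2 by (auto simp: p overpartitions_def mem_overpartitions_in)
  next
    case (3 q)
    obtain a M S M' S' where q: "q = (a, (M, S), (M', S'))" by (metis prod.collapse)
    from 3 have *: "\<And>x. x \<in># M \<Longrightarrow> odd x" "\<And>x. x \<in># M' \<Longrightarrow> even x" "S \<subseteq> set_mset M"
      "S' \<subseteq> set_mset M'" "sum_mset M = a"
      by (auto simp: q mem_overpartitions_in)
    then have f: "filter_mset odd M = M" "filter_mset odd M' = {#}" "filter_mset even M = {#}"
      "filter_mset even M' = M'"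
      by (auto simp: filter_mset_eq_conv)
    have "(S \<union> S') \<inter> Collect odd = S" "(S \<union> S') \<inter> Collect even = S'" using * by auto
    then show ?case by (simp add: q f *(5))
  next
    case (4 q)
    then show ?case by (auto simp: overpartitions_def mem_overpartitions_in)
  next
    case (5 p)
    obtain M S where p: "p = (M, S)" by force
    have "sum_mset M = sum_mset (filter_mset odd M) + sum_mset (filter_mset even M)"
      by (simp flip: sum_mset.union add: odd_even_mset_partition)
    then show ?case using 5
      by (auto simp: p overpartitions_def odd_parts_sum_def even_parts_sum_def simp del: of_nat_sum_mset)
  qed
  also have "\<dots> = (\<Sum>a=0..n. \<Sum>y\<in>?O a \<times> ?E (n - a). int a - int (n - a))"
    by (rule sum.Sigma [symmetric]) auto
  finally show ?thesis by (simp add: card_cartesian_product mult_ac)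
qed

text \<open>
  The factors \<open>a\<close> and \<open>n - a\<close> in the convolution are produced by the derivation
  \<open>f \<mapsto> X f'\<close>, so the generating function is \<open>X (O' E - O E')\<close>, where \<open>O\<close> and \<open>E\<close> count
  the overpartitions into odd and into even parts. This is the numerator of the derivative
  of \<open>O / E\<close>, and that quotient is \<open>\<theta>\<close>.
\<close>

lemma SOME_bar_gf:
  "Abs_fps SOME_bar = fps_X * fps_deriv theta * (overpartition_gf (Collect even))\<^sup>2"
proof -
  let ?O = "overpartition_gf (Collect odd)" and ?E = "overpartition_gf (Collect even)"
  have X_deriv: "fps_nth (fps_X * fps_deriv f) i = int i * fps_nth f i" for f i
    by (cases i) auto
  have "Abs_fps SOME_bar = (fps_X * fps_deriv ?O) * ?E - ?O * (fps_X * fps_deriv ?E)"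
    unfolding fps_eq_iff fps_sub_nth fps_mult_nth[of _ ?E] fps_mult_nth[of ?O] X_deriv
    by (simp add: SOME_bar_eq_convolution overpartition_gf_def sum_subtractf[symmetric] algebra_simps)
  also have "\<dots> = fps_X * fps_deriv theta * ?E\<^sup>2"
    by (simp add: odd_overpartition_gf power2_eq_square algebra_simps)
  finally show ?thesis .
qed

theorem corollary3:
  fixes n :: nat
  shows "SOME_bar n \<ge> 0"
proof -
  let ?E = "overpartition_gf (Collect even)"
  have mult: "\<forall>i. 0 \<le> fps_nth (f * g) i"
    if "\<forall>i. 0 \<le> fps_nth f i" "\<forall>i. 0 \<le> fps_nth g i" for f g :: "int fps"
    using that by (auto simp: fps_mult_nth intro!: sum_nonneg)
  have "\<forall>i. 0 \<le> fps_nth (fps_X * fps_deriv theta * ?E\<^sup>2) i"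
    unfolding power2_eq_square
    by (intro mult) (auto simp: theta_def overpartition_gf_def fps_X_def)
  then have "0 \<le> fps_nth (Abs_fps SOME_bar) n"
    unfolding SOME_bar_gf by blast
  then show ?thesis by simp
qed

end
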